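(* For every $x\in(0,\pi/2)$ the following inequality holds: $$x+\frac{x^3}{3}<\tan x<x+\frac{\tan^3x}{3}.$$
   Context: Here $\tan^3 x$ means $(\tan x)^3$. *)

theory Defs
  imports Complex_Main
begin

end

theory Submission
  imports Defs
begin

text \<open>
  The two claims and the auxiliary \<open>x < tan x\<close> compare functions that agree at the origin, so
  it suffices to compare their derivatives between 0 and \<open>pi / 2\<close>. Writing \<open>t = tan x\<close>, the
  function \<open>tan\<close> solves \<open>t' = 1 + t\<^sup>2\<close>, which turns every derivative into a polynomial in
  \<open>t\<close> and \<open>x\<close>:

  \<^item> \<open>(t - x)' = t\<^sup>2 > 0\<close>, whence \<open>x < t\<close>;
  \<^item> \<open>(t - x - x\<^sup>3/3)' = t\<^sup>2 - x\<^sup>2\<close>, which is positive by the previous inequality;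
  \<^item> \<open>(x + t\<^sup>3/3 - t)' = 1 + t\<^sup>2 (1 + t\<^sup>2) - (1 + t\<^sup>2) = t\<^sup>4 > 0\<close>.
\<close>

text \<open>The differential equation of the tangent, a form of the derivative that stays polynomial
  in \<open>tan\<close>.\<close>

lemma DERIV_tan_polynomial:
  fixes x :: real
  assumes "cos x \<noteq> 0"
  shows "(tan has_real_derivative 1 + tan x ^ 2) (at x)"
  using DERIV_tan[OF assms] unfolding tan_sec[OF assms] power_inverse .

text \<open>The monotonicity argument shared by the three inequalities. Positivity of the derivative is
  demanded only away from 0, because the derivative vanishes at 0 in each application.\<close>

lemma positive_if_derivative_positive:
  fixes f f' :: "real \<Rightarrow> real"
  assumes "0 < x" "f 0 = 0"
    and deriv: "\<And>y. 0 \<le> y \<Longrightarrow> y \<le> x \<Longrightarrow> (f has_real_derivative f' y) (at y)"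
    and pos: "\<And>y. 0 < y \<Longrightarrow> y < x \<Longrightarrow> f' y > 0"
  shows "f x > 0"
proof -
  have "isCont f y" if "y \<in> {0..x}" for y
    using deriv[of y] that DERIV_isCont by auto
  then have "continuous_on {0..x} f"
    by (simp add: continuous_at_imp_continuous_on)
  moreover have "\<exists>d. (f has_real_derivative d) (at y) \<and> d > 0" if "0 < y" "y < x" for y
    using deriv[of y] pos[of y] that by auto
  ultimately have "f 0 < f x"
    using \<open>0 < x\<close> DERIV_pos_imp_increasing_open by blast
  with \<open>f 0 = 0\<close> show ?thesis by simp
qed

lemma less_tan:
  fixes x :: real
  assumes "0 < x" "x < pi / 2"
  shows "x < tan x"
proof -
  have "tan x - x > 0"
  proof (rule positive_if_derivative_positive[where x = x
        and f = "\<lambda>y. tan y - y" and f' = "\<lambda>y. tan y ^ 2"])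
    fix y assume "0 \<le> y" "y \<le> x"
    then have "cos y \<noteq> 0" using assms cos_gt_zero_pi[of y] by auto
    note tan' = DERIV_tan_polynomial[OF this]
    show "((\<lambda>y. tan y - y) has_real_derivative tan y ^ 2) (at y)"
      by (rule tan' derivative_eq_intros refl | simp)+
  next
    fix y assume "0 < y" "y < x"
    then show "tan y ^ 2 > 0" using assms tan_gt_zero[of y] by simp
  qed (use assms in auto)
  then show ?thesis by simp
qed

theorem proposition1:
  fixes x :: real
  assumes "x \<in> {0<..<pi / 2}"
  shows "x + x ^ 3 / 3 < tan x \<and> tan x < x + (tan x) ^ 3 / 3"
proof
  have x: "0 < x" "x < pi / 2" using assms by auto
  have cos: "cos y \<noteq> 0" if "0 \<le> y" "y \<le> x" for y
    using that x cos_gt_zero_pi[of y] by auto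
  have "tan x - x - x ^ 3 / 3 > 0"
  proof (rule positive_if_derivative_positive[where x = x
        and f = "\<lambda>y. tan y - y - y ^ 3 / 3" and f' = "\<lambda>y. tan y ^ 2 - y ^ 2"])
    fix y assume "0 \<le> y" "y \<le> x"
    note tan' = DERIV_tan_polynomial[OF cos[OF this]]
    show "((\<lambda>y. tan y - y - y ^ 3 / 3) has_real_derivative tan y ^ 2 - y ^ 2) (at y)"
      by (rule tan' derivative_eq_intros refl | simp)+
  next
    fix y assume "0 < y" "y < x"
    then have "y ^ 2 < tan y ^ 2"
      using x less_tan[of y] by (intro power_strict_mono) auto
    then show "tan y ^ 2 - y ^ 2 > 0" by simp
  qed (use x in auto)
  then show "x + x ^ 3 / 3 < tan x" by simp
  have "x + tan x ^ 3 / 3 - tan x > 0"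
  proof (rule positive_if_derivative_positive[where x = x
        and f = "\<lambda>y. y + tan y ^ 3 / 3 - tan y" and f' = "\<lambda>y. tan y ^ 4"])
    fix y assume "0 \<le> y" "y \<le> x"
    note tan' = DERIV_tan_polynomial[OF cos[OF this]]
    show "((\<lambda>y. y + tan y ^ 3 / 3 - tan y) has_real_derivative tan y ^ 4) (at y)"
      by (rule tan' derivative_eq_intros refl
          | simp add: algebra_simps power2_eq_square power4_eq_xxxx)+
  next
    fix y assume "0 < y" "y < x"
    then show "tan y ^ 4 > 0" using x tan_gt_zero[of y] by simp
  qed (use x in auto)
  then show "tan x < x + (tan x) ^ 3 / 3" by simp
qed

end
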